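(* Let $M\ge 2$ be an integer, $S=\{0,1,\dots,M\}$, and let $P\colon S\times S\to[0,1]$ satisfy $P(a,0)=1$ and $P(0,b)=0$ for all $a,b\in S\setminus\{0\}$. Suppose that the map $\varphi\colon S\to[0,1]$, $\varphi(x)=P(x,1)$, is nondecreasing and satisfies $$\varphi(y)-\varphi(x)\le \varphi(x-y)\,[\varphi(y)-1]\qquad\text{for all } x,y\in S \text{ with } y\le x.$$ Consider the two-person red-and-black game with total fortune $M$ and win probability function $P$. If player II plays the timid strategy, then the bold strategy is best for player I.
   Context: The two-person red-and-black game with total fortune $M$ (an integer $M\ge2$) and win probability function $P\colon S\times S\to[0,1]$, $S=\{0,\dots,M\}$, is as follows. Player I has initial fortune $x_0\in\mathbb N$ and player II has initial fortune $y_0\in\mathbb N$ (positive integers) with $x_0+y_0=M$. $X_n$ and $Y_n$ denote the fortunes of players I and II at stage $n\in\mathbb N$; $X_1=x_0$, $Y_1=y_0$. At stage $n$ the players simultaneously bid integers $a_n\in\{0,\dots,X_n\}$ (player I) and $b_n\in\{0,\dots,Y_n\}$ (player II), each without knowledge of the other's current bid; a player whose fortune is positive is not allowed to bid $0$. Given the bids, $$X_{n+1}=X_n+b_n \text{ with probability } P(a_n,b_n),\qquad X_{n+1}=X_n-a_n \text{ with probability } 1-P(a_n,b_n),$$ and $Y_{n+1}=M-X_{n+1}$. Under the boundary conditions $P(a,0)=1$, $P(0,b)=0$ for $a,b\ne0$, the states $X_n=0$ and $X_n=M$ are absorbing, and the game effectively ends when one of them is reached. The goal of each player is to reach fortune $M$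 (player I: $X_m=M$ for some $m$; player II: $Y_m=M$, i.e. $X_m=0$, for some $m$). The value $P(0,0)$ is never used and is arbitrary. A strategy of a player is a rule which at each stage $n$ prescribes an admissible bid as a function of the partial history $(X_1,\dots,X_n)$. The timid strategy: bid exactly one unit at each stage (while the own fortune is positive). The bold strategy: bid the entire current fortune at each stage. A strategy of a player is best (optimal) against a given strategy of the opponent if it maximizes, among all strategies of the player, the probability that the player reaches the goal $M$. *)

theory Defs
  imports "HOL-Probability.Probability"
begin

text \<open>
  Partial histories \<open>(X\<^sub>1, \<dots>, X\<^sub>n)\<close> of player I's fortune are nonempty lists, most recent fortune
  last; player II's fortune is \<open>M - X\<^sub>n\<close>. Strategies of either player depend on these histories.
\<close>

type_synonym strategy = "nat list \<Rightarrow> nat"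

definition fortune_I :: "nat list \<Rightarrow> nat" where
  "fortune_I h = last h"

definition fortune_II :: "nat \<Rightarrow> nat list \<Rightarrow> nat" where
  "fortune_II M h = M - last h"

definition admissible_bid :: "nat \<Rightarrow> nat \<Rightarrow> bool" where
  "admissible_bid f a \<longleftrightarrow> a \<in> {0..f} \<and> (f > 0 \<longrightarrow> a \<noteq> 0)"

text \<open>The argument \<open>fortune\<close> below is the function computing the own fortune of the player.\<close>

definition is_strategy :: "nat \<Rightarrow> (nat list \<Rightarrow> nat) \<Rightarrow> strategy \<Rightarrow> bool" where
  "is_strategy M fortune s \<longleftrightarrow>
     (\<forall>h. h \<noteq> [] \<and> set h \<subseteq> {0..M} \<longrightarrow> admissible_bid (fortune h) (s h))"

definition timid :: "(nat list \<Rightarrow> nat) \<Rightarrow> strategy" where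
  "timid fortune h = (if fortune h > 0 then 1 else 0)"

definition bold :: "(nat list \<Rightarrow> nat) \<Rightarrow> strategy" where
  "bold fortune h = fortune h"

lemma is_strategy_timid: "is_strategy M fortune (timid fortune)"
  by (auto simp: is_strategy_def admissible_bid_def timid_def)

lemma is_strategy_bold: "is_strategy M fortune (bold fortune)"
  by (auto simp: is_strategy_def admissible_bid_def bold_def)

text \<open>
  Conditional law of \<open>X\<^sub>n\<^sub>+\<^sub>1\<close> given the history \<open>h = (X\<^sub>1, \<dots>, X\<^sub>n)\<close>, when player I uses \<open>s\<close> and
  player II uses \<open>t\<close>. With \<open>P a 0 = 1\<close> and \<open>P 0 b = 0\<close> for \<open>a, b \<noteq> 0\<close>, the states \<open>M\<close> and \<open>0\<close> are
  absorbing under admissible bids, so the game needs no explicit stopping.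
\<close>

definition next_fortune ::
    "(nat \<Rightarrow> nat \<Rightarrow> real) \<Rightarrow> strategy \<Rightarrow> strategy \<Rightarrow> nat list \<Rightarrow> nat pmf" where
  "next_fortune P s t h =
     map_pmf (\<lambda>win. if win then last h + t h else last h - s h) (bernoulli_pmf (P (s h) (t h)))"

text \<open>Sequences are indexed from 0, i.e. \<open>\<omega> n\<close> stands for \<open>X\<^sub>n\<^sub>+\<^sub>1\<close>.\<close>

definition game_kernel ::
    "(nat \<Rightarrow> nat \<Rightarrow> real) \<Rightarrow> strategy \<Rightarrow> strategy \<Rightarrow> nat \<Rightarrow> nat \<Rightarrow> (nat \<Rightarrow> nat) \<Rightarrow> nat measure" where
  "game_kernel P s t x0 n \<omega> =
     measure_pmf (if n = 0 then return_pmf x0 else next_fortune P s t (map \<omega> [0..<n]))"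

lemma measurable_history:
  "(\<lambda>\<omega>. map \<omega> [0..<n]) \<in> measurable (PiM {0..<n} (\<lambda>_. count_space UNIV)) (count_space (UNIV :: nat list set))"
proof (subst measurable_count_space_eq2_countable, intro conjI ballI)
  fix h :: "nat list"
  let ?N = "PiM {0..<n} (\<lambda>_. count_space (UNIV :: nat set))"
  have "(\<lambda>\<omega>. map \<omega> [0..<n]) -` {h} \<inter> space ?N =
      (if length h = n then PiE {0..<n} (\<lambda>i. {h ! i}) else {})"
  proof -
    have "map \<omega> [0..<n] = h \<longleftrightarrow> length h = n \<and> (\<forall>i\<in>{0..<n}. \<omega> i = h ! i)" for \<omega>
    proof (cases "length h = n")
      case True
      then have "map \<omega> [0..<n] = h \<longleftrightarrow> (\<forall>i<n. map \<omega> [0..<n] ! i = h ! i)"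
        by (subst list_eq_iff_nth_eq) simp
      with True show ?thesis
        by (simp add: Ball_def)
    next
      case False
      moreover have "length (map \<omega> [0..<n]) = n"
        by simp
      ultimately show ?thesis
        by blast
    qed
    then have "(\<lambda>\<omega>. map \<omega> [0..<n]) -` {h} \<inter> space ?N =
        {\<omega> \<in> extensional {0..<n}. length h = n \<and> (\<forall>i\<in>{0..<n}. \<omega> i = h ! i)}"
      by (simp add: space_PiM vimage_def Int_def PiE_def conj_commute)
    also have "\<dots> = (if length h = n then PiE {0..<n} (\<lambda>i. {h ! i}) else {})"
      by (simp add: PiE_def Pi_def Int_def conj_commute Ball_def)
    finally show ?thesis .
  qed
  also have "\<dots> \<in> sets ?N"
    by (simp add: sets_PiM_I_finite)
  finally show "(\<lambda>\<omega>. map \<omega> [0..<n]) -` {h} \<inter> space ?N \<in> sets ?N" .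
qed auto

lemma Ionescu_Tulcea_game:
  "Ionescu_Tulcea (game_kernel P s t x0) (\<lambda>_. count_space UNIV)"
proof (rule Ionescu_Tulcea.intro)
  fix n :: nat
  have "measure_pmf \<in> measurable (count_space UNIV) (subprob_algebra (count_space (UNIV :: nat set)))"
    by (auto simp: space_subprob_algebra measure_pmf.subprob_space_axioms)
  then have "(\<lambda>h. measure_pmf (if n = 0 then return_pmf x0 else next_fortune P s t h))
      \<in> measurable (count_space UNIV) (subprob_algebra (count_space UNIV))"
    by (auto simp: space_subprob_algebra measure_pmf.subprob_space_axioms)
  from measurable_compose[OF measurable_history this]
  show "game_kernel P s t x0 n \<in>
      measurable (PiM {0..<n} (\<lambda>_. count_space UNIV)) (subprob_algebra (count_space UNIV))"
    by (simp add: game_kernel_def[abs_def])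
next
  fix n :: nat and \<omega>
  show "prob_space (game_kernel P s t x0 n \<omega>)"
    unfolding game_kernel_def by (rule measure_pmf.prob_space_axioms)
qed

text \<open>
  The law of the fortune sequence of player I: the Ionescu-Tulcea measure of the kernels above,
  on the product sigma-algebra over all sequences of naturals.
\<close>

definition game_law ::
    "(nat \<Rightarrow> nat \<Rightarrow> real) \<Rightarrow> strategy \<Rightarrow> strategy \<Rightarrow> nat \<Rightarrow> (nat \<Rightarrow> nat) measure" where
  "game_law P s t x0 =
     projective_family.lim UNIV
       (Ionescu_Tulcea.CI (game_kernel P s t x0) (\<lambda>_. count_space UNIV)) (\<lambda>_. count_space UNIV)"

lemma sets_game_law: "sets (game_law P s t x0) = sets (PiM UNIV (\<lambda>_. count_space UNIV))"
  and space_game_law: "space (game_law P s t x0) = UNIV"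
  and prob_space_game_law: "prob_space (game_law P s t x0)"
proof -
  interpret Ionescu_Tulcea "game_kernel P s t x0" "\<lambda>_. count_space UNIV"
    by (rule Ionescu_Tulcea_game)
  show "sets (game_law P s t x0) = sets (PiM UNIV (\<lambda>_. count_space UNIV))"
    by (simp add: game_law_def)
  show "space (game_law P s t x0) = UNIV"
    by (simp add: game_law_def space_PiM)
  have *: "space (PiM {} (\<lambda>_. count_space (UNIV :: nat set))) \<in> sets (PiM {} (\<lambda>_. count_space UNIV))"
    by (rule sets.top)
  have "prod_emb UNIV (\<lambda>_. count_space UNIV) {} (space (PiM {} (\<lambda>_. count_space (UNIV :: nat set))))
      = space PF.lim"
    by (auto simp: prod_emb_def space_PiM)
  moreover have "emeasure (CI {}) (space (PiM {} (\<lambda>_. count_space UNIV))) = 1"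
    using prob_space.emeasure_space_1[OF PF.prob_space_P[of "{}"]] by (simp add: PF.space_P)
  ultimately have "emeasure PF.lim (space PF.lim) = 1"
    using lim[OF _ *] by simp
  then show "prob_space (game_law P s t x0)"
    by (auto simp: game_law_def intro: prob_spaceI)
qed

definition win_prob_I ::
    "nat \<Rightarrow> (nat \<Rightarrow> nat \<Rightarrow> real) \<Rightarrow> nat \<Rightarrow> strategy \<Rightarrow> strategy \<Rightarrow> real" where
  "win_prob_I M P x0 s t =
     measure (game_law P s t x0) {\<omega> \<in> space (game_law P s t x0). \<exists>n. \<omega> n = M}"

definition best_for_I ::
    "nat \<Rightarrow> (nat \<Rightarrow> nat \<Rightarrow> real) \<Rightarrow> nat \<Rightarrow> strategy \<Rightarrow> strategy \<Rightarrow> bool" where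
  "best_for_I M P x0 t s \<longleftrightarrow>
     is_strategy M fortune_I s \<and>
     (\<forall>s'. is_strategy M fortune_I s' \<longrightarrow> win_prob_I M P x0 s' t \<le> win_prob_I M P x0 s t)"

text \<open>The winning event is measurable, so \<^term>\<open>win_prob_I\<close> is a genuine probability.\<close>

lemma win_event_measurable:
  "{\<omega> \<in> space (game_law P s t x0). \<exists>n. \<omega> n = M} \<in> sets (game_law P s t x0)"
proof -
  have "{\<omega> \<in> space (PiM UNIV (\<lambda>_. count_space (UNIV :: nat set))). \<exists>n::nat. \<omega> n = M}
      \<in> sets (PiM UNIV (\<lambda>_. count_space UNIV))"
    by measurable
  then show ?thesis
    by (simp add: sets_game_law space_game_law space_PiM)
qed

end

theory Submission
  imports Defs
begin

text \<open>
  Against timid play, bold play wins exactly along the path \<open>x\<^sub>0, x\<^sub>0 + 1, \<dots>, M\<close>, since the first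
  lost bet ruins player I; hence its value is \<open>V x = \<phi>(x) \<phi>(x + 1) \<dots> \<phi>(M - 1)\<close>. It is enough that \<open>V\<close>
  is excessive, that is \<open>\<phi>(a) V(x + 1) + (1 - \<phi>(a)) V(x - a) \<le> V x\<close> for each bid \<open>a\<close>:
  then no strategy reaches \<open>M\<close> with probability above \<open>V x\<^sub>0\<close>. For \<open>a < x\<close> the excessive inequality follows
  from the hypothesis at \<open>y = a\<close> and \<open>V(x - a) \<le> \<phi>(x - a) V(x + 1)\<close>; for \<open>a = x\<close> it is an equality.
\<close>

section \<open>Laws of finite histories\<close>

text \<open>Discrete law of the first \<open>n\<close> fortunes, on which both bounds are computed
  without the product measure. As in \<open>game_kernel\<close>, the first entry is
  \<open>x0\<close>, so \<open>n\<close> entries cover \<open>n - 1\<close> stages of play.\<close>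

primrec history ::
    "(nat \<Rightarrow> nat \<Rightarrow> real) \<Rightarrow> strategy \<Rightarrow> strategy \<Rightarrow> nat \<Rightarrow> nat \<Rightarrow> nat list pmf" where
  "history P s t x0 0 = return_pmf []"
| "history P s t x0 (Suc n) = bind_pmf (history P s t x0 n)
     (\<lambda>h. map_pmf (\<lambda>x. h @ [x]) (if h = [] then return_pmf x0 else next_fortune P s t h))"

text \<open>Induction on \<open>n\<close>: pushing forward to lists turns the coordinate added by
  \<open>eP\<close> into an appended entry.\<close>

lemma distr_C_eq_history:
  "distr (Ionescu_Tulcea.C (game_kernel P s t x0) (\<lambda>_. count_space UNIV) 0 n (\<lambda>_. undefined))
     (count_space UNIV) (\<lambda>\<omega>. map \<omega> [0..<n]) = measure_pmf (history P s t x0 n)"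
proof -
  interpret Ionescu_Tulcea "game_kernel P s t x0" "\<lambda>_. count_space UNIV"
    by (rule Ionescu_Tulcea_game)
  let ?N = "\<lambda>n::nat. PiM {0..<n} (\<lambda>_. count_space (UNIV :: nat set))"
  let ?C = "\<lambda>n. C 0 n (\<lambda>_. undefined)"
  let ?K = "\<lambda>h. map_pmf (\<lambda>x. h @ [x]) (if h = [] then return_pmf x0 else next_fortune P s t h)"
  have C_space: "space (?C n) = space (?N n)" and C_sets: "sets (?C n) = sets (?N n)" for n
    using space_C[of "\<lambda>_. undefined" 0 n] sets_C[of "\<lambda>_. undefined" 0 n]
    by (simp_all add: space_PiM)
  have C_nonempty: "space (?C n) \<noteq> {}" for n
    unfolding C_space by (simp add: space_PiM PiE_eq_empty_iff)
  have meas_C: "measurable (?C n) X = measurable (?N n) X" for n and X :: "'x measure"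
    by (rule measurable_cong_sets[OF C_sets refl])
  show ?thesis
  proof (induction n)
    case 0
    have "space (?N 0) = {\<lambda>_. undefined}"
      by (simp add: space_PiM PiE_empty_domain)
    then show ?case
      by (auto intro!: measure_eqI simp: emeasure_distr emeasure_return sets_PiM_empty
          return_pmf.rep_eq split: split_indicator)
  next
    case (Suc n)
    have eP: "distr (eP n \<omega>) (count_space UNIV) (\<lambda>\<omega>. map \<omega> [0..<Suc n])
        = measure_pmf (?K (map \<omega> [0..<n]))" if \<omega>: "\<omega> \<in> space (?N n)" for \<omega>
    proof -
      have upd: "fun_upd \<omega> n \<in> measurable (game_kernel P s t x0 n \<omega>) (?N (Suc n))"
        using \<omega> by (intro measurable_fun_upd[where J="{0..<n}"])
          (auto simp: game_kernel_def)
      have "distr (eP n \<omega>) (count_space UNIV) (\<lambda>\<omega>. map \<omega> [0..<Suc n])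
          = distr (game_kernel P s t x0 n \<omega>) (count_space UNIV) (\<lambda>x. map \<omega> [0..<n] @ [x])"
        unfolding eP_def
        by (subst distr_distr[OF measurable_history upd]) (auto simp: comp_def intro!: distr_cong)
      then show ?thesis
        unfolding game_kernel_def map_pmf_rep_eq by simp
    qed
    have K: "(\<lambda>h. measure_pmf (?K h)) \<in>
        measurable (count_space UNIV) (subprob_algebra (count_space UNIV))"
      by (auto simp: space_subprob_algebra intro!: measure_pmf.subprob_space_axioms)
    have eP_measurable: "eP n \<in> measurable (?C n) (subprob_algebra (?N (Suc n)))"
      unfolding meas_C by (rule measurable_eP)
    have "distr (?C (Suc n)) (count_space UNIV) (\<lambda>\<omega>. map \<omega> [0..<Suc n])
        = ?C n \<bind> (\<lambda>\<omega>. distr (eP n \<omega>) (count_space UNIV) (\<lambda>\<omega>. map \<omega> [0..<Suc n]))"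
      unfolding C.simps add_0
      by (rule distr_bind[OF eP_measurable C_nonempty measurable_history])
    also have "\<dots> = ?C n \<bind> (\<lambda>\<omega>. measure_pmf (?K (map \<omega> [0..<n])))"
      by (intro bind_cong refl eP) (simp add: C_space)
    \<comment> \<open>The integrand depends on the sequence only through its list, so the bind
      passes to the image measure, where the induction hypothesis applies.\<close>
    also have "\<dots> = distr (?C n) (count_space UNIV) (\<lambda>\<omega>. map \<omega> [0..<n]) \<bind> (\<lambda>h. measure_pmf (?K h))"
      by (rule bind_distr[symmetric, OF _ K C_nonempty]) (simp only: meas_C measurable_history)
    also have "\<dots> = measure_pmf (history P s t x0 (Suc n))"
      by (simp only: Suc.IH history.simps measure_pmf_bind)
    finally show ?case .
  qed
qed

text \<open>The event is a cylinder over the first \<open>n\<close> coordinates, and there the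
  projective limit agrees with the iterated kernel \<open>C\<close>.\<close>

lemma emeasure_game_law_history:
  "emeasure (game_law P s t x0) {\<omega>. map \<omega> [0..<n] \<in> A} = emeasure (history P s t x0 n) A"
proof -
  interpret Ionescu_Tulcea "game_kernel P s t x0" "\<lambda>_. count_space UNIV"
    by (rule Ionescu_Tulcea_game)
  let ?N = "PiM {0..<n} (\<lambda>_. count_space (UNIV :: nat set))"
  let ?C = "C 0 n (\<lambda>_. undefined)"
  let ?X = "(\<lambda>\<omega>. map \<omega> [0..<n]) -` A \<inter> space ?N"
  have X: "?X \<in> sets ?N"
    by (rule measurable_sets[OF measurable_history]) simp
  have C: "space ?C = space ?N" "sets ?C = sets ?N"
    using space_C[of "\<lambda>_. undefined" 0 n] sets_C[of "\<lambda>_. undefined" 0 n]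
    by (simp_all add: space_PiM)
  have restrict: "map (restrict \<omega> {0..<n}) [0..<n] = map \<omega> [0..<n]" for \<omega> :: "nat \<Rightarrow> nat"
    by simp
  have "{\<omega>. map \<omega> [0..<n] \<in> A} = PF.emb UNIV {0..<n} ?X"
    by (auto simp: prod_emb_def space_PiM restrict simp del: restrict_apply map_eq_conv)
  then have "emeasure (game_law P s t x0) {\<omega>. map \<omega> [0..<n] \<in> A} = emeasure (CI {0..<n}) ?X"
    using lim[OF _ X] by (simp add: game_law_def)
  also have "\<dots> = emeasure ?C (PF.emb {0..<n} {0..<n} ?X)"
    by (rule emeasure_CI[OF subset_refl X])
  also have "PF.emb {0..<n} {0..<n} ?X = ?X"
    by (rule prod_emb_id) (auto simp: space_PiM)
  also have "emeasure ?C ?X = emeasure (distr ?C (count_space UNIV) (\<lambda>\<omega>. map \<omega> [0..<n])) A"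
    by (subst emeasure_distr)
      (simp_all only: measurable_cong_sets[OF C(2) refl] measurable_history C(1), simp)
  finally show ?thesis
    by (simp only: distr_C_eq_history)
qed

text \<open>Continuity from below: the events that \<open>M\<close> occurs among the first
  \<open>n\<close> fortunes increase to the winning event.\<close>

lemma win_prob_I_eq_SUP_history:
  "ennreal (win_prob_I M P x0 s t) = (SUP n. emeasure (history P s t x0 n) {h. M \<in> set h})"
proof -
  interpret prob_space "game_law P s t x0"
    by (rule prob_space_game_law)
  let ?A = "\<lambda>n. {\<omega>. map \<omega> [0..<n] \<in> {h. M \<in> set h}}"
  have sets: "?A n \<in> sets (game_law P s t x0)" for n
  proof -
    have "{\<omega> \<in> space (PiM UNIV (\<lambda>_. count_space (UNIV :: nat set))). \<exists>k<n. \<omega> k = M}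
        \<in> sets (PiM UNIV (\<lambda>_. count_space UNIV))"
      by measurable
    moreover have "?A n = {\<omega> \<in> space (PiM UNIV (\<lambda>_. count_space (UNIV :: nat set))). \<exists>k<n. \<omega> k = M}"
      by (auto simp: space_PiM)
    ultimately show ?thesis
      by (simp only: sets_game_law)
  qed
  have "{\<omega> \<in> space (game_law P s t x0). \<exists>n. \<omega> n = M} = (\<Union>n. ?A n)"
  proof -
    have "(\<exists>n. \<omega> n = M) \<longleftrightarrow> (\<exists>n. \<exists>k<n. \<omega> k = M)" for \<omega> :: "nat \<Rightarrow> nat"
      by (blast intro: lessI)
    then show ?thesis
      by (auto simp: space_game_law image_iff Bex_def)
  qed
  then have "ennreal (win_prob_I M P x0 s t) = emeasure (game_law P s t x0) (\<Union>n. ?A n)"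
    by (simp only: win_prob_I_def emeasure_eq_measure)
  also have "\<dots> = (SUP n. emeasure (game_law P s t x0) (?A n))"
    using sets by (intro SUP_emeasure_incseq[symmetric]) (auto simp: incseq_def)
  finally show ?thesis
    by (simp only: emeasure_game_law_history)
qed

section \<open>Upper bound by an excessive function\<close>

text \<open>Player II bids at most \<open>M - last h\<close>, and a loss of player I only lowers the
  fortune. This places reachable histories where the excessive inequality is assumed.\<close>

lemma set_history:
  assumes "is_strategy M (fortune_II M) t" and "x0 \<le> M"
    and "h \<in> set_pmf (history P s t x0 n)"
  shows "set h \<subseteq> {0..M}"
  using assms(3)
proof (induction n arbitrary: h)
  case (Suc n)
  then obtain g x where h: "h = g @ [x]" and g: "g \<in> set_pmf (history P s t x0 n)"
    and x: "x \<in> set_pmf (if g = [] then return_pmf x0 else next_fortune P s t g)"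
    by auto
  have IH: "set g \<subseteq> {0..M}"
    by (rule Suc.IH[OF g])
  have "x \<le> M"
  proof (cases "g = []")
    case False
    then have "last g \<le> M"
      using IH last_in_set[of g] by (meson atLeastAtMost_iff subsetD)
    moreover have "t g \<le> M - last g"
      using assms(1) IH False
      by (auto simp: is_strategy_def admissible_bid_def fortune_II_def)
    ultimately show ?thesis
      using x False by (auto simp: next_fortune_def split: if_splits)
  qed (use x assms(2) in auto)
  with IH h show ?case
    by auto
qed auto

text \<open>Excessivity is required only before \<open>M\<close> is reached: the proof stops \<open>V\<close> at that time.\<close>

lemma win_prob_I_le_excessive:
  fixes V :: "nat \<Rightarrow> ennreal"
  assumes t: "is_strategy M (fortune_II M) t" and x0: "x0 \<le> M" and V: "V M = 1"
    and excessive: "\<And>h. h \<noteq> [] \<Longrightarrow> set h \<subseteq> {0..M} \<Longrightarrow> M \<notin> set h \<Longrightarrow>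
      (\<integral>\<^sup>+x. V x \<partial>next_fortune P s t h) \<le> V (last h)"
  shows "ennreal (win_prob_I M P x0 s t) \<le> V x0"
proof -
  \<comment> \<open>\<open>W\<close> follows \<open>V\<close> along the history and freezes at 1
    once \<open>M\<close> has occurred; its value at the empty list makes the induction start from
    \<open>V x0\<close>. It is a supermartingale dominating the indicator of winning.\<close>
  define W where "W h = (if M \<in> set h then 1 else if h = [] then V x0 else V (last h))" for h
  have W_bound: "(\<integral>\<^sup>+h. W h \<partial>history P s t x0 n) \<le> V x0" if "x0 \<noteq> M" for n
  proof (induction n)
    case 0
    then show ?case
      by (simp add: W_def)
  next
    case (Suc n)
    have step: "(\<integral>\<^sup>+x. W (h @ [x]) \<partial>(if h = [] then return_pmf x0 else next_fortune P s t h)) \<le> W h"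
      if "h \<in> set_pmf (history P s t x0 n)" for h
    proof (cases "h = [] \<or> M \<in> set h")
      case True
      then show ?thesis
        using \<open>x0 \<noteq> M\<close> by (auto simp: W_def)
    next
      case False
      then have "W (h @ [x]) = V x" for x
        using V by (auto simp: W_def)
      with False show ?thesis
        using excessive[of h] set_history[OF t x0 that] by (simp add: W_def)
    qed
    have "(\<integral>\<^sup>+h. W h \<partial>history P s t x0 (Suc n)) \<le> (\<integral>\<^sup>+h. W h \<partial>history P s t x0 n)"
      unfolding history.simps nn_integral_bind_pmf nn_integral_map_pmf
      by (intro nn_integral_mono_AE) (auto simp only: AE_measure_pmf_iff step)
    with Suc.IH show ?case
      by (rule order_trans[rotated])
  qed
  have "emeasure (history P s t x0 n) {h. M \<in> set h} \<le> V x0" for n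
  proof (cases "x0 = M")
    case True
    then show ?thesis
      by (simp add: V measure_pmf.emeasure_le_1)
  next
    case False
    have "emeasure (history P s t x0 n) {h. M \<in> set h}
        = (\<integral>\<^sup>+h. indicator {h. M \<in> set h} h \<partial>history P s t x0 n)"
      by simp
    also have "\<dots> \<le> (\<integral>\<^sup>+h. W h \<partial>history P s t x0 n)"
      by (intro nn_integral_mono) (auto simp: W_def split: split_indicator)
    also have "\<dots> \<le> V x0"
      by (rule W_bound[OF False])
    finally show ?thesis .
  qed
  then show ?thesis
    unfolding win_prob_I_eq_SUP_history by (intro SUP_least)
qed

section \<open>Path probabilities and the product formula\<close>

text \<open>The extended list determines its prefix, so a single term of the bind survives.\<close>

lemma pmf_history_snoc:
  assumes "h \<noteq> []"
  shows "pmf (history P s t x0 (Suc n)) (h @ [x]) = pmf (history P s t x0 n) h * pmf (next_fortune P s t h) x"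
proof -
  have inj: "inj (\<lambda>x. g @ [x])" for g :: "nat list"
    by (auto simp: inj_def)
  have "pmf (map_pmf (\<lambda>x. g @ [x]) (if g = [] then return_pmf x0 else next_fortune P s t g)) (h @ [x])
      = pmf (next_fortune P s t h) x * indicator {h} g" for g
  proof (cases "g = h")
    case True
    then show ?thesis
      using assms by (simp add: pmf_map_inj'[OF inj])
  next
    case False
    then have "pmf (map_pmf (\<lambda>x. g @ [x]) (if g = [] then return_pmf x0 else next_fortune P s t g)) (h @ [x]) = 0"
      by (intro pmf_map_outside) auto
    with False show ?thesis
      by simp
  qed
  then show ?thesis
    by (simp add: pmf_bind measure_pmf_single)
qed

lemma excessive_prod:
  fixes \<phi> :: "nat \<Rightarrow> real"
  assumes \<phi>01: "\<And>x. x \<le> M \<Longrightarrow> 0 \<le> \<phi> x \<and> \<phi> x \<le> 1" and \<phi>0: "\<phi> 0 = 0"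
    and \<phi>: "\<And>x y. x \<le> M \<Longrightarrow> y \<le> x \<Longrightarrow> \<phi> y - \<phi> x \<le> \<phi> (x - y) * (\<phi> y - 1)"
    and x: "x < M" and a: "a \<le> x"
  shows "\<phi> a * prod \<phi> {Suc x..<M} + (1 - \<phi> a) * prod \<phi> {x - a..<M} \<le> prod \<phi> {x..<M}"
proof -
  let ?V = "\<lambda>x. prod \<phi> {x..<M}"
  have nonneg: "0 \<le> ?V y" for y
    by (intro prod_nonneg) (auto simp: \<phi>01)
  have rec: "?V y = \<phi> y * ?V (Suc y)" if "y < M" for y
    by (rule prod.atLeast_Suc_lessThan[OF that])
  show ?thesis
  proof (cases "a = x")
    case True
    have "?V 0 = 0"
      using rec[of 0] x \<phi>0 by (simp only: mult_zero_left)
    with True rec[OF x] show ?thesis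
      by (simp only: diff_self_eq_0)
  next
    case False
    \<comment> \<open>The factors with indices from \<open>x - a + 1\<close> to \<open>x\<close> are
      at most 1 and are dropped. Everything is thus compared with multiples of
      \<open>?V (Suc x)\<close>, and \<phi>(a) + (1 - \<phi>(a)) \<phi>(x - a) \<le> \<phi>(x)
      remains, a rearrangement of the hypothesis.\<close>
    have "?V (Suc (x - a)) = prod \<phi> {Suc (x - a)..<Suc x} * ?V (Suc x)"
      using x a by (intro prod.atLeastLessThan_concat[symmetric]) auto
    also have "\<dots> \<le> 1 * ?V (Suc x)"
      using x by (intro mult_right_mono nonneg prod_le_1) (auto simp: \<phi>01)
    finally have "?V (x - a) \<le> \<phi> (x - a) * ?V (Suc x)"
      using rec[of "x - a"] x \<phi>01[of "x - a"] by (simp add: mult_left_mono)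
    then have "(1 - \<phi> a) * ?V (x - a) \<le> (1 - \<phi> a) * (\<phi> (x - a) * ?V (Suc x))"
      using \<phi>01[of a] x a by (intro mult_left_mono) auto
    also have "\<dots> = (\<phi> (x - a) * (1 - \<phi> a)) * ?V (Suc x)"
      by simp
    also have "\<dots> \<le> (\<phi> x - \<phi> a) * ?V (Suc x)"
      using \<phi>[of x a] x a by (intro mult_right_mono nonneg) (auto simp: algebra_simps)
    finally show ?thesis
      using rec[OF x] by (simp add: algebra_simps)
  qed
qed

lemma nn_integral_next_fortune:
  assumes "0 \<le> P (s h) (t h)" and "P (s h) (t h) \<le> 1" and "\<And>x. 0 \<le> V x"
  shows "(\<integral>\<^sup>+x. ennreal (V x) \<partial>next_fortune P s t h)
    = ennreal (P (s h) (t h) * V (last h + t h) + (1 - P (s h) (t h)) * V (last h - s h))"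
  using assms unfolding next_fortune_def
  by (simp add: ennreal_mult ennreal_plus mult.commute flip: ennreal_mult ennreal_plus)

text \<open>The list is the path of \<open>n\<close> consecutive wins. An inequality suffices, since
  the path only serves to bound the winning probability from below.\<close>

lemma pmf_history_bold:
  assumes P01: "\<And>x. x < M \<Longrightarrow> 0 \<le> P x 1 \<and> P x 1 \<le> 1" and M: "x0 + n \<le> M"
  shows "(\<Prod>k = x0..<x0 + n. P k 1)
    \<le> pmf (history P (bold fortune_I) (timid (fortune_II M)) x0 (Suc n)) [x0..<Suc (x0 + n)]"
  using M
proof (induction n)
  case 0
  then show ?case
    by (simp add: bind_return_pmf)
next
  case (Suc n)
  let ?s = "bold fortune_I" and ?t = "timid (fortune_II M)"
  let ?h = "[x0..<Suc (x0 + n)]"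
  have h: "?h \<noteq> []" "last ?h = x0 + n" "?s ?h = x0 + n" "?t ?h = 1"
    using Suc.prems by (simp_all add: bold_def timid_def fortune_I_def fortune_II_def)
  have p: "0 \<le> P (x0 + n) 1" "P (x0 + n) 1 \<le> 1"
    using P01[of "x0 + n"] Suc.prems by auto
  have "P (x0 + n) 1 = pmf (bernoulli_pmf (P (x0 + n) 1)) True"
    using p by simp
  \<comment> \<open>The outcome \<open>True\<close> lies in the preimage of this fortune, so
    monotonicity of the measure gives the bound.\<close>
  also have "\<dots> \<le> pmf (next_fortune P ?s ?t ?h) (Suc (x0 + n))"
    unfolding next_fortune_def h pmf_map unfolding pmf.rep_eq
    by (intro measure_pmf.finite_measure_mono) auto
  finally have "(\<Prod>k = x0..<x0 + n. P k 1) * P (x0 + n) 1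
      \<le> pmf (history P ?s ?t x0 (Suc n)) ?h * pmf (next_fortune P ?s ?t ?h) (Suc (x0 + n))"
    using Suc.IH Suc.prems p by (intro mult_mono) auto
  also have "\<dots> = pmf (history P ?s ?t x0 (Suc (Suc n))) (?h @ [Suc (x0 + n)])"
    by (rule pmf_history_snoc[OF h(1), symmetric])
  finally show ?case
    by simp
qed

theorem theorem2:
  fixes M x0 y0 :: nat and P :: "nat \<Rightarrow> nat \<Rightarrow> real"
  assumes "M \<ge> 2"
    and "\<forall>a\<in>{0..M}. \<forall>b\<in>{0..M}. P a b \<in> {0..1}"
    and "\<forall>a\<in>{0..M} - {0}. P a 0 = 1"
    and "\<forall>b\<in>{0..M} - {0}. P 0 b = 0"
    and "mono_on {0..M} (\<lambda>x. P x 1)"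
    and "\<forall>x\<in>{0..M}. \<forall>y\<in>{0..M}. y \<le> x \<longrightarrow> P y 1 - P x 1 \<le> P (x - y) 1 * (P y 1 - 1)"
    and "x0 > 0" and "y0 > 0" and "x0 + y0 = M"
  shows "best_for_I M P x0 (timid (fortune_II M)) (bold fortune_I)"
proof -
  let ?s = "bold fortune_I" and ?t = "timid (fortune_II M)"
  define V where "V x = (\<Prod>k = x..<M. P k 1)" for x
  \<comment> \<open>\<open>M \<ge> 2\<close> places player II's bid 1 in
    \<open>{0..M}\<close>.\<close>
  have P01: "0 \<le> P x 1 \<and> P x 1 \<le> 1" if "x \<le> M" for x
    using assms(1,2) that by auto
  have V_nonneg: "0 \<le> V x" for x
    unfolding V_def by (intro prod_nonneg) (use P01 in auto)
  have upper: "ennreal (win_prob_I M P x0 s ?t) \<le> ennreal (V x0)" if s: "is_strategy M fortune_I s" for s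
  proof (rule win_prob_I_le_excessive[where V = "\<lambda>x. ennreal (V x)", OF is_strategy_timid])
    fix h :: "nat list"
    assume h: "h \<noteq> []" "set h \<subseteq> {0..M}" "M \<notin> set h"
    then have "last h \<in> set h"
      by simp
    with h have last: "last h < M"
      by (metis atLeastAtMost_iff le_neq_implies_less subsetD)
    have bid: "s h \<le> last h"
      using s h by (auto simp: is_strategy_def admissible_bid_def fortune_I_def)
    have t: "?t h = 1"
      using last by (simp add: timid_def fortune_II_def)
    have "(\<integral>\<^sup>+x. ennreal (V x) \<partial>next_fortune P s ?t h)
        = ennreal (P (s h) 1 * V (Suc (last h)) + (1 - P (s h) 1) * V (last h - s h))"
      using P01[of "s h"] bid last by (subst nn_integral_next_fortune) (simp_all add: t V_nonneg)
    also have "\<dots> \<le> ennreal (V (last h))"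
      unfolding V_def
      using assms(1,4,6) last bid
      by (intro ennreal_leI excessive_prod[where \<phi> = "\<lambda>k. P k 1"] P01) auto
    finally show "(\<integral>\<^sup>+x. ennreal (V x) \<partial>next_fortune P s ?t h) \<le> ennreal (V (last h))" .
  qed (use assms in \<open>auto simp: V_def\<close>)
  \<comment> \<open>Exactly \<open>y0\<close> wins lead from \<open>x0\<close> to \<open>M\<close>,
    giving a history of \<open>Suc y0\<close> entries.\<close>
  have "V x0 \<le> pmf (history P ?s ?t x0 (Suc y0)) [x0..<Suc M]"
    using pmf_history_bold[of M P x0 y0] P01 assms(9) by (simp add: V_def)
  also have "\<dots> \<le> measure (history P ?s ?t x0 (Suc y0)) {h. M \<in> set h}"
    unfolding pmf.rep_eq using assms(9) by (intro measure_pmf.finite_measure_mono) auto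
  finally have "ennreal (V x0) \<le> emeasure (history P ?s ?t x0 (Suc y0)) {h. M \<in> set h}"
    by (simp add: measure_pmf.emeasure_eq_measure ennreal_leI)
  also have "\<dots> \<le> ennreal (win_prob_I M P x0 ?s ?t)"
    unfolding win_prob_I_eq_SUP_history by (rule SUP_upper) simp
  finally have lower: "ennreal (V x0) \<le> ennreal (win_prob_I M P x0 ?s ?t)" .
  show ?thesis
    unfolding best_for_I_def
  proof (intro conjI allI impI is_strategy_bold)
    fix s
    assume "is_strategy M fortune_I s"
    from order_trans[OF upper[OF this] lower]
    show "win_prob_I M P x0 s ?t \<le> win_prob_I M P x0 ?s ?t"
      \<comment> \<open>Unfolding exposes a measure, which is nonnegative, so the comparison in
        \<open>ennreal\<close> descends to the reals.\<close>
      by (simp add: win_prob_I_def)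
  qed
qed

end
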